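(* Let $\gamma(x,t)$ be a solution of the central affine curve flow $\gamma_t=\frac14q_x\gamma-\frac12q\gamma_x$ on $\mathbb{R}^2\setminus\{0\}$ with central affine curvature $q$, and let $E$ be an extended frame for $q$ with $E(x,t,0)=(\gamma,\gamma_x)$. Let $\xi_1\neq\xi_2$ and $k_1\neq k_2$ be real constants with $k_1k_2\neq0$. For $i=1,2$ let $$\begin{pmatrix} y_{1i} \\ y_{2i} \end{pmatrix}=E(x,t,k_i^2)^{-1}\begin{pmatrix}-\xi_i\\1\end{pmatrix},\qquad\tilde\xi_i=-\frac{y_{1i}}{y_{2i}},\qquad\gamma_i=\frac1{k_i}(\tilde\xi_i\gamma-\gamma_x),$$ and let $$\tilde\xi_{12}=-\tilde\xi_1+\frac{k_1^2-k_2^2}{\tilde\xi_1-\tilde\xi_2},$$ on an open set $\mathcal{O}\subset\mathbb{R}^2$ on which $y_{21},y_{22}$ and $\tilde\xi_1-\tilde\xi_2$ do not vanish. Then, on $\mathcal{O}$, $$\gamma_{12}=\frac1{k_2}\bigl(\tilde\xi_{12}\gamma_1-(\gamma_1)_x\bigr)$$ is a solution of the central affine curve flow with central affine curvature $q_{12}=q-2(\tilde\xi_1^2-k_1^2)+2(\tilde\xi_{12}^2-k_2^2)$.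
   Context: A solution of the central affine curve flow $\gamma_t=\frac14q_x\gamma-\frac12q\gamma_x$ is a smooth map $\gamma(x,t)$ into $\mathbb{R}^2\setminus\{0\}$ (column vectors) with $\det(\gamma,\gamma_x)=1$ satisfying this equation, where $q(\cdot,t)$ is the central affine curvature of $\gamma(\cdot,t)$, i.e. the unique smooth function with $\gamma_{xx}=q\gamma$. The given solution $\gamma$ is defined for $(x,t)\in\mathbb{R}^2$. It is known that $q$ then solves the KdV equation $q_t=\frac14(q_{xxx}-6qq_x)$. An extended frame of a solution $q$ of the KdV equation is a solution $E(x,t,\lambda)\in SL(2,\mathbb{C})$, holomorphic in $\lambda\in\mathbb{C}$ and satisfying $\overline{E(x,t,\bar\lambda)}=E(x,t,\lambda)$, of $$E_x=E\begin{pmatrix}0&\lambda+q\\1&0\end{pmatrix},\qquad E_t=E\begin{pmatrix}\frac14q_x&\lambda^2+\frac12q\lambda+\frac14(q_{xx}-2q^2)\\ \lambda-\frac q2&-\frac14q_x\end{pmatrix}.$$ $(\gamma,\gamma_x)$ denotes the $2\times2$ matrix with columns $\gamma,\gamma_x$. *)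

theory Defs
  imports "HOL-Analysis.Analysis" "HOL-Complex_Analysis.Complex_Analysis"
begin

text \<open>
  Functions of \<open>(x, t)\<close> are functions on \<^typ>\<open>real \<times> real\<close>, with \<open>x\<close> the first coordinate.
  The notions below are only meant for open sets \<open>S\<close>; there all derivatives depend only
  on the values of the function on \<open>S\<close>.
\<close>

text \<open>Class \<open>C\<^sup>n\<close> on an open set, by iterating Frechet derivatives in every fixed direction.\<close>

fun Cn_on :: "nat \<Rightarrow> 'a::real_normed_vector set \<Rightarrow> ('a \<Rightarrow> 'b::real_normed_vector) \<Rightarrow> bool" where
  "Cn_on 0 S f \<longleftrightarrow> continuous_on S f"
| "Cn_on (Suc n) S f \<longleftrightarrow> (\<forall>p\<in>S. f differentiable (at p)) \<and>
     (\<forall>v. Cn_on n S (\<lambda>p. frechet_derivative f (at p) v))"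

definition smooth_on :: "'a::real_normed_vector set \<Rightarrow> ('a \<Rightarrow> 'b::real_normed_vector) \<Rightarrow> bool" where
  "smooth_on S f \<longleftrightarrow> (\<forall>n. Cn_on n S f)"

definition Dx :: "(real \<times> real \<Rightarrow> 'b::real_normed_vector) \<Rightarrow> real \<times> real \<Rightarrow> 'b" where
  "Dx f p = vector_derivative (\<lambda>x. f (x, snd p)) (at (fst p))"

definition Dt :: "(real \<times> real \<Rightarrow> 'b::real_normed_vector) \<Rightarrow> real \<times> real \<Rightarrow> 'b" where
  "Dt f p = vector_derivative (\<lambda>t. f (fst p, t)) (at (snd p))"

definition columns2 :: "'a::zero ^ 2 \<Rightarrow> 'a ^ 2 \<Rightarrow> 'a ^ 2 ^ 2" where
  "columns2 u v = transpose (vector [u, v])"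

definition central_affine_curvature ::
  "(real \<times> real) set \<Rightarrow> (real \<times> real \<Rightarrow> real ^ 2) \<Rightarrow> (real \<times> real \<Rightarrow> real) \<Rightarrow> bool" where
  "central_affine_curvature S \<gamma> q \<longleftrightarrow>
     smooth_on S q \<and> (\<forall>p\<in>S. Dx (Dx \<gamma>) p = q p *\<^sub>R \<gamma> p)"

text \<open>\<open>\<gamma>\<close> solves the central affine curve flow on \<open>S\<close>, and its curvature is \<open>q\<close>.\<close>

definition central_affine_curve_flow ::
  "(real \<times> real) set \<Rightarrow> (real \<times> real \<Rightarrow> real ^ 2) \<Rightarrow> (real \<times> real \<Rightarrow> real) \<Rightarrow> bool" where
  "central_affine_curve_flow S \<gamma> q \<longleftrightarrow>
     smooth_on S \<gamma> \<and>
     (\<forall>p\<in>S. \<gamma> p \<noteq> 0) \<and>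
     (\<forall>p\<in>S. det (columns2 (\<gamma> p) (Dx \<gamma> p)) = 1) \<and>
     central_affine_curvature S \<gamma> q \<and>
     (\<forall>p\<in>S. Dt \<gamma> p = (1/4 * Dx q p) *\<^sub>R \<gamma> p - (1/2 * q p) *\<^sub>R Dx \<gamma> p)"

text \<open>Both matrices are given by their rows; \<open>\<mu>\<close> is the spectral parameter.\<close>

definition lax_x :: "(real \<times> real \<Rightarrow> real) \<Rightarrow> real \<times> real \<Rightarrow> complex \<Rightarrow> complex ^ 2 ^ 2" where
  "lax_x q p \<mu> = vector
     [vector [0, \<mu> + of_real (q p)],
      vector [1, 0]]"

definition lax_t :: "(real \<times> real \<Rightarrow> real) \<Rightarrow> real \<times> real \<Rightarrow> complex \<Rightarrow> complex ^ 2 ^ 2" where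
  "lax_t q p \<mu> = vector
     [vector [of_real (1/4 * Dx q p),
              \<mu>^2 + of_real (1/2 * q p) * \<mu> + of_real (1/4 * (Dx (Dx q) p - 2 * (q p)^2))],
      vector [\<mu> - of_real (q p / 2), - of_real (1/4 * Dx q p)]]"

text \<open>
  Differentiability in \<open>(x, t)\<close> is all that is required of \<open>E\<close>: if \<open>q\<close> is smooth, the two
  differential equations then force \<open>E\<close> to be smooth in \<open>(x, t)\<close> for every \<open>\<mu>\<close>.
\<close>

definition extended_frame ::
  "(real \<times> real \<Rightarrow> real) \<Rightarrow> (real \<times> real \<Rightarrow> complex \<Rightarrow> complex ^ 2 ^ 2) \<Rightarrow> bool" where
  "extended_frame q E \<longleftrightarrow>
     (\<forall>p \<mu>. det (E p \<mu>) = 1) \<and>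
     (\<forall>p i j. (\<lambda>\<mu>. E p \<mu> $ i $ j) holomorphic_on UNIV) \<and>
     (\<forall>p \<mu>. map_matrix cnj (E p (cnj \<mu>)) = E p \<mu>) \<and>
     (\<forall>\<mu> p. (\<lambda>p. E p \<mu>) differentiable (at p)) \<and>
     (\<forall>\<mu> p. Dx (\<lambda>p. E p \<mu>) p = E p \<mu> ** lax_x q p \<mu>) \<and>
     (\<forall>\<mu> p. Dt (\<lambda>p. E p \<mu>) p = E p \<mu> ** lax_t q p \<mu>)"

definition frame_vector ::
  "(real \<times> real \<Rightarrow> complex \<Rightarrow> complex ^ 2 ^ 2) \<Rightarrow> real \<Rightarrow> real \<Rightarrow> real \<times> real \<Rightarrow> complex ^ 2" where
  "frame_vector E k \<xi> p =
     matrix_inv (E p (of_real (k^2))) *v vector [- of_real \<xi>, 1]"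

text \<open>
  The quotient is real for an extended frame (shown in \<open>of_real_xi_tilde\<close> below), so \<^const>\<open>Re\<close>
  only changes the type.
\<close>

definition xi_tilde ::
  "(real \<times> real \<Rightarrow> complex \<Rightarrow> complex ^ 2 ^ 2) \<Rightarrow> real \<Rightarrow> real \<Rightarrow> real \<times> real \<Rightarrow> real" where
  "xi_tilde E k \<xi> p = Re (- (frame_vector E k \<xi> p $ 1) / (frame_vector E k \<xi> p $ 2))"

lemma cnj_frame_vector:
  assumes "extended_frame q E"
  shows "cnj (frame_vector E k \<xi> p $ i) = frame_vector E k \<xi> p $ i"
proof -
  define M where "M = E p (of_real (k^2))"
  define y where "y = frame_vector E k \<xi> p"
  define z :: "complex ^ 2" where "z = (\<chi> i. cnj (y $ i))"
  define b :: "complex ^ 2" where "b = vector [- of_real \<xi>, 1]"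
  have M_real: "cnj (M $ i $ j) = M $ i $ j" for i j
  proof -
    have "map_matrix cnj (E p (cnj (of_real (k^2)))) = E p (of_real (k^2))"
      using assms unfolding extended_frame_def by blast
    then have "map_matrix cnj M = M"
      by (simp add: M_def)
    then show ?thesis
      by (metis nth_map_matrix)
  qed
  have b_real: "cnj (b $ i) = b $ i" for i
    using exhaust_2[of i] by (auto simp: b_def)
  have "det M = 1"
    using assms unfolding extended_frame_def M_def by blast
  then have "\<exists>N. M ** N = mat 1 \<and> N ** M = mat 1"
    using invertible_det_nz[of M] by (simp add: invertible_def)
  then have inv: "M ** matrix_inv M = mat 1 \<and> matrix_inv M ** M = mat 1"
    unfolding matrix_inv_def by (rule someI_ex)
  have My: "M *v y = b"
    using inv unfolding y_def frame_vector_def M_def[symmetric] b_def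
    by (simp add: matrix_vector_mul_assoc)
  have "M *v z = b"
  proof -
    have "(M *v z) $ i = b $ i" for i
    proof -
      have "(M *v z) $ i = cnj ((M *v y) $ i)"
        by (simp add: matrix_vector_mult_def z_def M_real)
      then show ?thesis
        by (simp add: My b_real)
    qed
    then show ?thesis
      by (simp add: vec_eq_iff)
  qed
  then have "matrix_inv M *v (M *v z) = matrix_inv M *v (M *v y)"
    by (simp add: My)
  then have "z = y"
    by (simp add: matrix_vector_mul_assoc inv)
  then show ?thesis
    by (metis y_def z_def vec_lambda_beta)
qed

lemma of_real_xi_tilde:
  assumes "extended_frame q E"
  shows "of_real (xi_tilde E k \<xi> p) = - (frame_vector E k \<xi> p $ 1) / (frame_vector E k \<xi> p $ 2)"
proof -
  have "cnj (- (frame_vector E k \<xi> p $ 1) / (frame_vector E k \<xi> p $ 2)) =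
    - (frame_vector E k \<xi> p $ 1) / (frame_vector E k \<xi> p $ 2)"
    by (simp add: cnj_frame_vector[OF assms])
  then show ?thesis
    unfolding xi_tilde_def by (metis Reals_cnj_iff of_real_Re)
qed

definition baecklund ::
  "real \<Rightarrow> (real \<times> real \<Rightarrow> real) \<Rightarrow> (real \<times> real \<Rightarrow> real ^ 2) \<Rightarrow> real \<times> real \<Rightarrow> real ^ 2" where
  "baecklund k \<eta> \<gamma> p = (1 / k) *\<^sub>R (\<eta> p *\<^sub>R \<gamma> p - Dx \<gamma> p)"

end

theory Submission
  imports Defs
begin

text \<open>
  The frame \<open>(\<gamma>, \<gamma>\<^sub>x)\<close> satisfies linear equations in \<open>x\<close> and in \<open>t\<close>, the Lax pair at spectral parameter
  \<open>0\<close>. For \<open>\<mu> = k\<^sup>2\<close> a vector \<open>y = E\<^sup>-\<^sup>1 b\<close> with constant \<open>b\<close> satisfies \<open>y\<^sub>x = - A y\<close> and \<open>y\<^sub>t = - B y\<close> with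
  the Lax matrices at \<open>\<mu>\<close>; in particular \<open>(y\<^sub>2)\<^sub>x\<^sub>x = (q + \<mu>) y\<^sub>2\<close>. For the logarithmic derivative
  \<open>h = (y\<^sub>2)\<^sub>x / y\<^sub>2 = - y\<^sub>1 / y\<^sub>2\<close> this linear system becomes a pair of Riccati equations, called
  \<open>riccati_pair\<close>, of which the first is \<open>h\<^sub>x = q + \<mu> - h\<^sup>2\<close>. Each \<open>\<xi>t\<^sub>i\<close> satisfies it with \<open>\<mu> = k\<^sub>i\<^sup>2\<close>
  (\<open>riccati_pair_xi_tilde\<close>), and from there on the proof is algebra with Riccati pairs.

  Two facts carry the proof. Both concern the Darboux transform \<open>Q = 2 (h\<^sup>2 - \<mu>) - q\<close> of the potential.

  \<^item> If \<open>h\<close> solves the Riccati pair for \<open>q\<close> at \<open>k\<^sup>2\<close>, then \<open>(h \<gamma> - \<gamma>\<^sub>x) / k\<close> solves the curve flow with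
    curvature \<open>Q\<close> (\<open>framed_flow_baecklund\<close>). The derivatives of \<open>h \<gamma> - \<gamma>\<^sub>x\<close> are again combinations of
    \<open>\<gamma>\<close> and \<open>\<gamma>\<^sub>x\<close>, and one compares coefficients.

  \<^item> If \<open>h\<^sub>1\<close> and \<open>h\<^sub>2\<close> solve the Riccati pairs for \<open>q\<close> at \<open>\<mu>\<^sub>1\<close> and \<open>\<mu>\<^sub>2\<close>, then
    \<open>- h\<^sub>1 + (\<mu>\<^sub>1 - \<mu>\<^sub>2) / (h\<^sub>1 - h\<^sub>2)\<close> solves the one for the transformed potential at \<open>\<mu>\<^sub>2\<close>
    (\<open>riccati_pair_permutability\<close>). This is the logarithmic derivative of the Darboux transform
    \<open>\<psi>\<^sub>x - h\<^sub>1 \<psi> = (h\<^sub>2 - h\<^sub>1) \<psi>\<close> of a function \<open>\<psi>\<close> with \<open>\<psi>\<^sub>x = h\<^sub>2 \<psi>\<close>.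

  The first fact gives \<open>\<gamma>\<^sub>1\<close>, with curvature \<open>q\<^sub>1 = 2 (\<xi>t\<^sub>1\<^sup>2 - k\<^sub>1\<^sup>2) - q\<close>; by the second, \<open>\<xi>t\<^sub>1\<^sub>2\<close> solves the Riccati
  pair for \<open>q\<^sub>1\<close> at \<open>k\<^sub>2\<^sup>2\<close>; and the first fact, applied to \<open>\<gamma>\<^sub>1\<close>, gives \<open>\<gamma>\<^sub>1\<^sub>2\<close> with curvature
  \<open>2 (\<xi>t\<^sub>1\<^sub>2\<^sup>2 - k\<^sub>2\<^sup>2) - q\<^sub>1\<close>, which is \<open>q\<^sub>1\<^sub>2\<close>.

  The Riccati pair also yields smoothness: its right-hand sides are polynomials in \<open>h\<close> with smooth
  coefficients, so a differentiable solution is smooth (\<open>riccati_pair_smooth\<close>).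
\<close>

(* "$" is to denote components of vectors only; otherwise iterated components are ambiguous. *)
no_notation fps_nth (infixl "$" 75)

section \<open>Partial derivatives\<close>

lemma has_derivative_imp_Dx:
  assumes "(f has_derivative f') (at p)"
  shows "Dx f p = f' (1, 0)"
proof -
  have "((\<lambda>x. (x, snd p)) has_vector_derivative (1, 0)) (at (fst p))"
    by (auto intro!: derivative_eq_intros simp: has_vector_derivative_def)
  moreover have "(f has_derivative f') (at (fst p, snd p) within range (\<lambda>x. (x, snd p)))"
    using assms by (simp add: has_derivative_at_withinI)
  ultimately have "(f \<circ> (\<lambda>x. (x, snd p)) has_vector_derivative f' (1, 0)) (at (fst p))"
    by (rule vector_derivative_diff_chain_within)
  then show ?thesis
    unfolding Dx_def comp_def by (rule vector_derivative_at)
qed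

lemma has_derivative_imp_Dt:
  assumes "(f has_derivative f') (at p)"
  shows "Dt f p = f' (0, 1)"
proof -
  have "((\<lambda>t. (fst p, t)) has_vector_derivative (0, 1)) (at (snd p))"
    by (auto intro!: derivative_eq_intros simp: has_vector_derivative_def)
  moreover have "(f has_derivative f') (at (fst p, snd p) within range (\<lambda>t. (fst p, t)))"
    using assms by (simp add: has_derivative_at_withinI)
  ultimately have "(f \<circ> (\<lambda>t. (fst p, t)) has_vector_derivative f' (0, 1)) (at (snd p))"
    by (rule vector_derivative_diff_chain_within)
  then show ?thesis
    unfolding Dt_def comp_def by (rule vector_derivative_at)
qed

text \<open>
  Total differentiability with prescribed partial derivatives. It is stable under transformation on
  open sets and under algebraic operations, whereas equations for \<^const>\<open>Dx\<close> and \<^const>\<open>Dt\<close>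
  alone do not imply that the function is differentiable.
\<close>

abbreviation has_partials ::
  "(real \<times> real \<Rightarrow> 'b::real_normed_vector) \<Rightarrow> 'b \<Rightarrow> 'b \<Rightarrow> real \<times> real \<Rightarrow> bool" where
  "has_partials f a b p \<equiv> (f has_derivative (\<lambda>v. fst v *\<^sub>R a + snd v *\<^sub>R b)) (at p)"

lemma has_partialsD:
  assumes "has_partials f a b p"
  shows "Dx f p = a" "Dt f p = b"
  using has_derivative_imp_Dx[OF assms] has_derivative_imp_Dt[OF assms] by simp_all

text \<open>
  A linear map on the plane is determined by its values at the two unit vectors, and the values of
  the total derivative there are the partial derivatives.
\<close>

lemma differentiable_imp_has_partials:
  assumes "f differentiable at p"
  shows "has_partials f (Dx f p) (Dt f p) p"
proof -
  obtain f' where f': "(f has_derivative f') (at p)"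
    using assms by (auto simp: differentiable_def)
  interpret f': linear f'
    by (rule has_derivative_linear[OF f'])
  have "f' v = fst v *\<^sub>R f' (1, 0) + snd v *\<^sub>R f' (0, 1)" for v
  proof -
    have "v = fst v *\<^sub>R (1, 0) + snd v *\<^sub>R (0, 1)"
      by (simp add: prod_eq_iff)
    then show ?thesis
      by (metis f'.add f'.scale)
  qed
  then have "f' = (\<lambda>v. fst v *\<^sub>R Dx f p + snd v *\<^sub>R Dt f p)"
    unfolding has_derivative_imp_Dx[OF f'] has_derivative_imp_Dt[OF f'] by (rule ext)
  with f' show ?thesis by simp
qed

lemma has_partials_transform:
  assumes "open S" "p \<in> S" "\<And>r. r \<in> S \<Longrightarrow> f r = g r" "has_partials f a b p"
  shows "has_partials g a b p"
  using has_derivative_transform_within_open[OF assms(4,1,2)] assms(3) by blast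

lemma has_partials_bounded_linear:
  assumes "bounded_linear L" "has_partials f a b p"
  shows "has_partials (\<lambda>r. L (f r)) (L a) (L b) p"
proof -
  interpret bounded_linear L by fact
  show ?thesis
    using has_derivative[OF assms(2)] by (simp add: add scaleR)
qed

lemma has_partials_add:
  assumes "has_partials f a b p" "has_partials g c d p"
  shows "has_partials (\<lambda>r. f r + g r) (a + c) (b + d) p"
  using has_derivative_add[OF assms] by (simp add: algebra_simps)

lemma has_partials_minus:
  assumes "has_partials f a b p"
  shows "has_partials (\<lambda>r. - f r) (- a) (- b) p"
  using has_derivative_minus[OF assms] by simp

lemma has_partials_const: "has_partials (\<lambda>r. c) 0 0 p"
  by simp

lemma has_partials_diff:
  assumes "has_partials f a b p" "has_partials g c d p"
  shows "has_partials (\<lambda>r. f r - g r) (a - c) (b - d) p"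
  using has_partials_add[OF assms(1) has_partials_minus[OF assms(2)]] by simp

lemma has_partials_scaleR:
  assumes "has_partials f a b p" "has_partials g c d p"
  shows "has_partials (\<lambda>r. f r *\<^sub>R g r) (f p *\<^sub>R c + a *\<^sub>R g p) (f p *\<^sub>R d + b *\<^sub>R g p) p"
  using has_derivative_scaleR[OF assms] by (rule has_derivative_eq_rhs) (simp add: algebra_simps)

lemma has_partials_mult:
  fixes f g :: "real \<times> real \<Rightarrow> real"
  assumes "has_partials f a b p" "has_partials g c d p"
  shows "has_partials (\<lambda>r. f r * g r) (f p * c + a * g p) (f p * d + b * g p) p"
  using has_partials_scaleR[OF assms] by simp

lemma has_partials_power2:
  fixes f :: "real \<times> real \<Rightarrow> real"
  assumes "has_partials f a b p"
  shows "has_partials (\<lambda>r. (f r)^2) (2 * f p * a) (2 * f p * b) p"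
  using has_partials_mult[OF assms assms] by (simp add: power2_eq_square algebra_simps)

text \<open>
  The derivative of \<open>f / g\<close> is written as \<open>(f' - (f / g) g') / g\<close>, so that the quotient reappears as
  a unit; the Riccati equations express its derivative through the quotient itself.
\<close>

lemma has_partials_divide:
  fixes f g :: "real \<times> real \<Rightarrow> real"
  assumes "has_partials f a b p" "has_partials g c d p" "g p \<noteq> 0"
  shows "has_partials (\<lambda>r. f r / g r) ((a - f p / g p * c) / g p) ((b - f p / g p * d) / g p) p"
  by (rule derivative_eq_intros assms refl)+ (use assms(3) in \<open>simp add: fun_eq_iff field_simps\<close>)

lemmas has_partials_intros =
  has_partials_add has_partials_diff has_partials_minus has_partials_mult has_partials_scaleR
  has_partials_power2 has_partials_const

lemma has_partials_eq_rhs: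
  assumes "has_partials f a b p" "a = a'" "b = b'"
  shows "has_partials f a' b' p"
  using assms by simp

section \<open>Functions of class \<open>C\<^sup>n\<close>\<close>

lemma Cn_on_transform:
  assumes "open S"
  shows "(\<And>r. r \<in> S \<Longrightarrow> f r = g r) \<Longrightarrow> Cn_on n S f \<Longrightarrow> Cn_on n S g"
proof (induction n arbitrary: f g)
  case 0
  then show ?case
    by (metis Cn_on.simps(1) continuous_on_cong)
next
  case (Suc n)
  have d: "(f has_derivative frechet_derivative f (at p)) (at p)" if "p \<in> S" for p
    using Suc.prems(2) that by (simp add: frechet_derivative_works)
  have d': "(g has_derivative frechet_derivative f (at p)) (at p)" if "p \<in> S" for p
    using has_derivative_transform_within_open[OF d assms] that Suc.prems(1) by blast
  have "frechet_derivative f (at p) v = frechet_derivative g (at p) v" if "p \<in> S" for p v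
    using frechet_derivative_at[OF d'[OF that]] by simp
  moreover have "g differentiable at p" if "p \<in> S" for p
    using d'[OF that] by (auto simp: differentiable_def)
  ultimately show ?case
    using Suc.IH[of "\<lambda>p. frechet_derivative f (at p) v" "\<lambda>p. frechet_derivative g (at p) v" for v]
      Suc.prems(2) by simp
qed

text \<open>
  The recursive definition refers to \<^const>\<open>frechet_derivative\<close>. This rule accepts any formula for the
  derivative on \<open>S\<close>, which makes the closure properties below inductions on the differentiation rules.
\<close>

lemma Cn_on_SucI:
  assumes "open S" and "\<And>p. p \<in> S \<Longrightarrow> (f has_derivative f' p) (at p)"
    and "\<And>v. Cn_on n S (\<lambda>p. f' p v)"
  shows "Cn_on (Suc n) S f"
proof -
  have "f' p v = frechet_derivative f (at p) v" if "p \<in> S" for p v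
    using frechet_derivative_at[OF assms(2)[OF that]] by simp
  then have "Cn_on n S (\<lambda>p. frechet_derivative f (at p) v)" for v
    using Cn_on_transform[OF assms(1) _ assms(3)[of v]] by simp
  then show ?thesis
    using assms(2) by (auto simp: differentiable_def)
qed

lemma Cn_on_SucD: "Cn_on (Suc n) S f \<Longrightarrow> Cn_on n S f"
proof (induction n arbitrary: f)
  case 0
  then show ?case
    by (simp add: continuous_at_imp_continuous_on differentiable_imp_continuous_within)
next
  case (Suc n)
  show ?case
    using Suc.prems Suc.IH unfolding Cn_on.simps(2)[of "Suc n"] Cn_on.simps(2)[of n S f] by blast
qed

lemma Cn_on_has_derivative:
  assumes "Cn_on (Suc n) S f" "p \<in> S"
  shows "(f has_derivative frechet_derivative f (at p)) (at p)"
  using assms by (simp add: frechet_derivative_works)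

lemma Cn_on_const:
  assumes "open S" shows "Cn_on n S (\<lambda>p. c)"
  by (induction n arbitrary: c) auto

lemma Cn_on_add:
  assumes "open S"
  shows "Cn_on n S f \<Longrightarrow> Cn_on n S g \<Longrightarrow> Cn_on n S (\<lambda>p. f p + g p)"
proof (induction n arbitrary: f g)
  case 0
  then show ?case by (simp add: continuous_on_add)
next
  case (Suc n)
  show ?case
  proof (rule Cn_on_SucI[OF assms])
    show "((\<lambda>p. f p + g p) has_derivative
        (\<lambda>v. frechet_derivative f (at p) v + frechet_derivative g (at p) v)) (at p)" if "p \<in> S" for p
      by (intro has_derivative_add Cn_on_has_derivative[OF Suc.prems(1) that]
          Cn_on_has_derivative[OF Suc.prems(2) that])
    show "Cn_on n S (\<lambda>p. frechet_derivative f (at p) v + frechet_derivative g (at p) v)" for v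
      using Suc by simp
  qed
qed

text \<open>
  By the product rule the derivative is a sum of two products of functions of class \<open>n\<close>, because \<open>f\<close>
  and \<open>g\<close> are also of class \<open>n\<close>; the induction hypothesis applies to each product.
\<close>

lemma Cn_on_bounded_bilinear:
  assumes "bounded_bilinear B" "open S"
  shows "Cn_on n S f \<Longrightarrow> Cn_on n S g \<Longrightarrow> Cn_on n S (\<lambda>p. B (f p) (g p))"
proof (induction n arbitrary: f g)
  case 0
  then show ?case
    by (simp add: bounded_bilinear.continuous_on[OF assms(1)])
next
  case (Suc n)
  show ?case
  proof (rule Cn_on_SucI[OF assms(2)])
    show "((\<lambda>p. B (f p) (g p)) has_derivative
        (\<lambda>v. B (f p) (frechet_derivative g (at p) v) + B (frechet_derivative f (at p) v) (g p)))
        (at p)" if "p \<in> S" for p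
      by (intro bounded_bilinear.FDERIV[OF assms(1)] Cn_on_has_derivative[OF Suc.prems(1) that]
          Cn_on_has_derivative[OF Suc.prems(2) that])
    show "Cn_on n S (\<lambda>p. B (f p) (frechet_derivative g (at p) v) +
        B (frechet_derivative f (at p) v) (g p))" for v
      using Suc Cn_on_SucD[OF Suc.prems(1)] Cn_on_SucD[OF Suc.prems(2)]
      by (intro Cn_on_add[OF assms(2)]) simp_all
  qed
qed

lemmas Cn_on_scaleR = Cn_on_bounded_bilinear[OF bounded_bilinear_scaleR]
lemmas Cn_on_mult = Cn_on_bounded_bilinear[OF bounded_bilinear_mult]

lemma Cn_on_diff:
  assumes "open S" "Cn_on n S f" "Cn_on n S g"
  shows "Cn_on n S (\<lambda>p. f p - g p)"
  using Cn_on_add[OF assms(1,2) Cn_on_scaleR[OF assms(1) Cn_on_const[OF assms(1), where c = "-1"] assms(3)]]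
  by simp

lemma Cn_on_power:
  fixes f :: "'a::real_normed_vector \<Rightarrow> real"
  assumes "open S" "Cn_on n S f"
  shows "Cn_on n S (\<lambda>p. f p ^ m)"
  by (induction m) (use assms in \<open>auto intro: Cn_on_const Cn_on_mult\<close>)

lemmas Cn_on_intros = Cn_on_const Cn_on_add Cn_on_diff Cn_on_mult Cn_on_scaleR Cn_on_power

lemma smooth_on_imp_differentiable:
  assumes "smooth_on S f" "p \<in> S"
  shows "f differentiable at p"
  using assms(1)[unfolded smooth_on_def, THEN spec, of 1] assms(2) by simp

lemma smooth_on_Dx:
  assumes "open S" "smooth_on S f"
  shows "smooth_on S (Dx f)"
  unfolding smooth_on_def
proof
  fix n
  have f: "Cn_on (Suc n) S f"
    using assms(2) by (simp add: smooth_on_def del: Cn_on.simps)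
  have "frechet_derivative f (at p) (1, 0) = Dx f p" if "p \<in> S" for p
    using has_derivative_imp_Dx[OF Cn_on_has_derivative[OF f that]] by simp
  then show "Cn_on n S (Dx f)"
    using Cn_on_transform[OF assms(1), of "\<lambda>p. frechet_derivative f (at p) (1, 0)" "Dx f"] f by simp
qed

lemma smooth_on_transform:
  assumes "open S" "\<And>r. r \<in> S \<Longrightarrow> f r = g r" "smooth_on S f"
  shows "smooth_on S g"
  using assms(3) Cn_on_transform[OF assms(1,2)] unfolding smooth_on_def by simp

lemma smooth_on_subset:
  assumes "T \<subseteq> S" "smooth_on S f"
  shows "smooth_on T f"
proof -
  have "Cn_on n S f \<Longrightarrow> Cn_on n T f" for n
    by (induction n arbitrary: f) (use assms(1) in \<open>auto intro: continuous_on_subset\<close>)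
  then show ?thesis
    using assms(2) by (simp add: smooth_on_def)
qed

section \<open>Riccati equations of the Lax pair\<close>

text \<open>
  If \<open>y\<^sub>x = - A y\<close> and \<open>y\<^sub>t = - B y\<close> for the Lax matrices \<open>A\<close>, \<open>B\<close> at \<open>\<mu>\<close>, then \<open>h = - y\<^sub>1 / y\<^sub>2\<close> satisfies
  \<open>h\<^sub>x = A\<^sub>1\<^sub>2 - 2 A\<^sub>1\<^sub>1 h - A\<^sub>2\<^sub>1 h\<^sup>2\<close> and \<open>h\<^sub>t = B\<^sub>1\<^sub>2 - 2 B\<^sub>1\<^sub>1 h - B\<^sub>2\<^sub>1 h\<^sup>2\<close>, since both matrices are
  traceless. These two equations are spelled out here.
\<close>

definition riccati_pair ::
  "(real \<times> real) set \<Rightarrow> (real \<times> real \<Rightarrow> real) \<Rightarrow> real \<Rightarrow> (real \<times> real \<Rightarrow> real) \<Rightarrow> bool" where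
  "riccati_pair S q \<mu> h \<longleftrightarrow> (\<forall>p\<in>S. has_partials h
     (q p + \<mu> - (h p)^2)
     (\<mu>^2 + 1/2 * q p * \<mu> + 1/4 * (Dx (Dx q) p - 2 * (q p)^2)
       - 1/2 * Dx q p * h p - (\<mu> - 1/2 * q p) * (h p)^2) p)"

lemma riccati_pair_transform:
  assumes "open S" "\<And>p. p \<in> S \<Longrightarrow> h p = g p" "riccati_pair S q \<mu> h"
  shows "riccati_pair S q \<mu> g"
  unfolding riccati_pair_def
proof
  fix p assume p: "p \<in> S"
  show "has_partials g (q p + \<mu> - (g p)^2)
     (\<mu>^2 + 1/2 * q p * \<mu> + 1/4 * (Dx (Dx q) p - 2 * (q p)^2)
       - 1/2 * Dx q p * g p - (\<mu> - 1/2 * q p) * (g p)^2) p"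
    using has_partials_transform[OF assms(1) p, of h g] assms(2,3) p
    unfolding riccati_pair_def assms(2)[OF p, symmetric] by blast
qed

text \<open>
  The determinant of \<open>M\<close> is \<open>1\<close>, so Cramer's rule makes the entries of \<open>y = M\<^sup>-\<^sup>1 b\<close> linear
  in those of \<open>M\<close>, and \<open>y\<close> can be differentiated without differentiating a matrix inverse.
\<close>

lemma frame_vector_eq:
  fixes E :: "real \<times> real \<Rightarrow> complex \<Rightarrow> complex ^ 2 ^ 2" and p :: "real \<times> real" and k \<xi> :: real
  assumes "extended_frame q E"
  defines "M \<equiv> E p (of_real (k^2))"
  shows "frame_vector E k \<xi> p $ 1 = - (of_real \<xi> * M $ 2 $ 2 + M $ 1 $ 2)"
    and "frame_vector E k \<xi> p $ 2 = M $ 1 $ 1 + of_real \<xi> * M $ 2 $ 1"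
proof -
  define y where "y = frame_vector E k \<xi> p"
  have det: "det M = 1"
    using assms(1) unfolding extended_frame_def M_def by blast
  then have "M ** matrix_inv M = mat 1"
    using invertible_det_nz[of M] unfolding invertible_def matrix_inv_def
    by (intro someI_ex[THEN conjunct1]) simp
  then have My: "M *v y = vector [- of_real \<xi>, 1]"
    by (simp add: y_def frame_vector_def M_def matrix_vector_mul_assoc)
  have 1: "M $ 1 $ 1 * y $ 1 + M $ 1 $ 2 * y $ 2 = - of_real \<xi>"
    and 2: "M $ 2 $ 1 * y $ 1 + M $ 2 $ 2 * y $ 2 = 1"
    using arg_cong[OF My, of "\<lambda>v. v $ 1"] arg_cong[OF My, of "\<lambda>v. v $ 2"]
    by (simp_all add: matrix_vector_mult_def sum_2)
  show "frame_vector E k \<xi> p $ 1 = - (of_real \<xi> * M $ 2 $ 2 + M $ 1 $ 2)"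
    using 1 2 det unfolding det_2 y_def[symmetric] by algebra
  show "frame_vector E k \<xi> p $ 2 = M $ 1 $ 1 + of_real \<xi> * M $ 2 $ 1"
    using 1 2 det unfolding det_2 y_def[symmetric] by algebra
qed

text \<open>
  The equations \<open>y\<^sub>x = - A y\<close> and \<open>y\<^sub>t = - B y\<close>, in real form: at the real parameter \<open>k\<^sup>2\<close> the Lax
  matrices are real, so the real parts of \<open>y\<close> satisfy the same equations.
\<close>

lemma frame_vector_has_partials:
  fixes E :: "real \<times> real \<Rightarrow> complex \<Rightarrow> complex ^ 2 ^ 2" and k \<xi> :: real
  assumes "extended_frame q E"
  defines "a \<equiv> \<lambda>p. Re (frame_vector E k \<xi> p $ 1)" and "b \<equiv> \<lambda>p. Re (frame_vector E k \<xi> p $ 2)"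
  shows "has_partials a (- (k^2 + q p) * b p)
      (- (1/4 * Dx q p * a p + ((k^2)^2 + 1/2 * q p * k^2 + 1/4 * (Dx (Dx q) p - 2 * (q p)^2)) * b p)) p"
    and "has_partials b (- a p) (- ((k^2 - q p / 2) * a p - 1/4 * Dx q p * b p)) p"
proof -
  define M where "M = (\<lambda>p. E p (of_real (k^2)))"
  have M: "has_partials M (M p ** lax_x q p (of_real (k^2))) (M p ** lax_t q p (of_real (k^2))) p"
    using differentiable_imp_has_partials[of M p] assms(1)
    unfolding extended_frame_def M_def by simp
  have entry: "has_partials (\<lambda>p. M p $ i $ j)
      ((M p ** lax_x q p (of_real (k^2))) $ i $ j) ((M p ** lax_t q p (of_real (k^2))) $ i $ j) p" for i j
    by (rule has_partials_bounded_linear[OF _ M])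
      (intro bounded_linear_compose[OF bounded_linear_vec_nth bounded_linear_vec_nth, unfolded comp_def])
  have a: "a = (\<lambda>p. - (\<xi> * Re (M p $ 2 $ 2) + Re (M p $ 1 $ 2)))"
    and b: "b = (\<lambda>p. Re (M p $ 1 $ 1) + \<xi> * Re (M p $ 2 $ 1))"
    unfolding a_def b_def M_def frame_vector_eq[OF assms(1)] by simp_all
  note e = entry[THEN has_partials_bounded_linear[OF bounded_linear_Re]]
  note e11 = e[of 1 1] and e12 = e[of 1 2] and e21 = e[of 2 1] and e22 = e[of 2 2]
  note e' = e11 e12 e21 e22
  have Re_mult: "Re (z * of_real c) = Re z * c" for z c
    by simp
  have A: "(M p ** lax_x q p (of_real (k^2))) $ i $ 1 = M p $ i $ 2"
    "(M p ** lax_x q p (of_real (k^2))) $ i $ 2 = M p $ i $ 1 * of_real (k^2 + q p)"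
    "(M p ** lax_t q p (of_real (k^2))) $ i $ 1 =
      M p $ i $ 1 * of_real (1/4 * Dx q p) + M p $ i $ 2 * of_real (k^2 - q p / 2)"
    "(M p ** lax_t q p (of_real (k^2))) $ i $ 2 =
      M p $ i $ 1 * of_real ((k^2)^2 + 1/2 * q p * k^2 + 1/4 * (Dx (Dx q) p - 2 * (q p)^2))
      + M p $ i $ 2 * of_real (- (1/4 * Dx q p))" for i
    by (simp_all add: matrix_matrix_mult_def sum_2 lax_x_def lax_t_def)
  note e'' = e'[unfolded A plus_complex.sel Re_mult]
  show "has_partials a (- (k^2 + q p) * b p)
      (- (1/4 * Dx q p * a p + ((k^2)^2 + 1/2 * q p * k^2 + 1/4 * (Dx (Dx q) p - 2 * (q p)^2)) * b p)) p"
    unfolding a b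
    by (rule derivative_eq_intros e'' refl)+ (simp add: fun_eq_iff algebra_simps)
  show "has_partials b (- a p) (- ((k^2 - q p / 2) * a p - 1/4 * Dx q p * b p)) p"
    unfolding a b
    by (rule derivative_eq_intros e'' refl)+ (simp add: fun_eq_iff algebra_simps)
qed

lemma riccati_pair_xi_tilde:
  assumes "extended_frame q E" and "\<forall>p\<in>S. frame_vector E k \<xi> p $ 2 \<noteq> 0"
  shows "riccati_pair S q (k^2) (xi_tilde E k \<xi>)"
  unfolding riccati_pair_def
proof
  fix p assume p: "p \<in> S"
  define a where "a = (\<lambda>p. Re (frame_vector E k \<xi> p $ 1))"
  define b where "b = (\<lambda>p. Re (frame_vector E k \<xi> p $ 2))"
  have real: "frame_vector E k \<xi> p $ 1 = of_real (a p)" "frame_vector E k \<xi> p $ 2 = of_real (b p)" for p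
    using cnj_frame_vector[OF assms(1), of k \<xi> p] by (simp_all add: a_def b_def complex_eq_iff)
  have Re: "Re (frame_vector E k \<xi> p $ 1) = a p" "Re (frame_vector E k \<xi> p $ 2) = b p" for p
    by (simp_all add: a_def b_def)
  define h where "h = (\<lambda>p. - (a p / b p))"
  have xi: "xi_tilde E k \<xi> = h"
    by (simp add: fun_eq_iff xi_tilde_def real h_def)
  have b: "b p \<noteq> 0"
    using assms(2) p real(2)[of p] by auto
  then have a: "a p = - (h p * b p)"
    by (simp add: h_def)
  note ab = frame_vector_has_partials[OF assms(1), where k = k and \<xi> = \<xi> and p = p, unfolded Re]
  show "has_partials (xi_tilde E k \<xi>) (q p + k^2 - (xi_tilde E k \<xi> p)^2)
     ((k^2)^2 + 1/2 * q p * k^2 + 1/4 * (Dx (Dx q) p - 2 * (q p)^2)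
       - 1/2 * Dx q p * xi_tilde E k \<xi> p - (k^2 - 1/2 * q p) * (xi_tilde E k \<xi> p)^2) p"
    using has_derivative_minus[OF has_partials_divide[OF ab b], folded h_def] unfolding xi
    by (rule has_derivative_eq_rhs)
      (use b in \<open>simp add: a fun_eq_iff field_simps power2_eq_square\<close>)
qed

text \<open>
  Bootstrap: the partial derivatives of \<open>h\<close> are polynomials in \<open>h\<close>, \<open>q\<close> and the \<open>x\<close>-derivatives of \<open>q\<close>,
  so if \<open>h\<close> is of class \<open>n\<close>, then so is its derivative, and \<open>h\<close> is of class \<open>n + 1\<close>.
\<close>

lemma riccati_pair_smooth:
  assumes "open S" "smooth_on S q" "riccati_pair S q \<mu> h"
  shows "smooth_on S h"
  unfolding smooth_on_def
proof
  fix n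
  have h: "(h has_derivative (\<lambda>v. fst v * (q p + \<mu> - (h p)^2) + snd v *
     (\<mu>^2 + 1/2 * q p * \<mu> + 1/4 * (Dx (Dx q) p - 2 * (q p)^2)
       - 1/2 * Dx q p * h p - (\<mu> - 1/2 * q p) * (h p)^2))) (at p)" if "p \<in> S" for p
    using assms(3) that by (simp add: riccati_pair_def)
  have q: "Cn_on n S q" "Cn_on n S (Dx q)" "Cn_on n S (Dx (Dx q))" for n
    using assms(2) smooth_on_Dx[OF assms(1)] unfolding smooth_on_def by blast+
  show "Cn_on n S h"
  proof (induction n)
    case 0
    have "continuous (at p) h" if "p \<in> S" for p
      using has_derivative_continuous[OF h[OF that]] by simp
    then show ?case
      by (simp add: continuous_at_imp_continuous_on)
  next
    case (Suc n)
    show ?case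
      by (rule Cn_on_SucI[OF assms(1) h])
        (intro Cn_on_intros assms(1) q Suc | assumption)+
  qed
qed

section \<open>Darboux transformation of potential and Riccati solution\<close>

text \<open>
  The \<open>x\<close>-derivatives of the transformed potential enter the \<open>t\<close>-equations. The Riccati equation
  removes all derivatives of \<open>h\<close> from them, which reduces later verifications to polynomial identities.
\<close>

lemma darboux_potential_partials:
  assumes "open S" "smooth_on S q" "riccati_pair S q \<mu> h" "p \<in> S"
  defines "Q \<equiv> \<lambda>p. 2 * ((h p)^2 - \<mu>) - q p"
  shows "Dx Q p = 4 * h p * (q p + \<mu> - (h p)^2) - Dx q p"
    and "Dx (Dx Q) p = 4 * (q p + \<mu> - (h p)^2)^2
      + 4 * h p * (Dx q p - 2 * h p * (q p + \<mu> - (h p)^2)) - Dx (Dx q) p"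
proof -
  have q: "has_partials q (Dx q r) (Dt q r) r" "has_partials (Dx q) (Dx (Dx q) r) (Dt (Dx q) r) r"
    if "r \<in> S" for r
    using that smooth_on_Dx[OF assms(1,2)] assms(2)
    by (blast intro: differentiable_imp_has_partials smooth_on_imp_differentiable)+
  have h: "has_partials h (q r + \<mu> - (h r)^2) (Dt h r) r" if "r \<in> S" for r
  proof -
    note h = assms(3)[unfolded riccati_pair_def, rule_format, OF that]
    show ?thesis
      using h unfolding has_partialsD(2)[OF h] .
  qed
  have Q: "Dx Q r = 4 * h r * (q r + \<mu> - (h r)^2) - Dx q r" if "r \<in> S" for r
  proof -
    have "has_partials Q (4 * h r * (q r + \<mu> - (h r)^2) - Dx q r) (4 * h r * Dt h r - Dt q r) r"
      unfolding Q_def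
      by (rule has_partials_eq_rhs, (rule has_partials_intros q[OF that] h[OF that])+)
        (simp_all add: algebra_simps)
    then show ?thesis
      by (rule has_partialsD)
  qed
  show "Dx Q p = 4 * h p * (q p + \<mu> - (h p)^2) - Dx q p"
    using Q assms(4) .
  have "has_partials (\<lambda>r. 4 * h r * (q r + \<mu> - (h r)^2) - Dx q r)
     (4 * (q p + \<mu> - (h p)^2)^2
      + 4 * h p * (Dx q p - 2 * h p * (q p + \<mu> - (h p)^2)) - Dx (Dx q) p)
     (4 * Dt h p * (q p + \<mu> - (h p)^2)
      + 4 * h p * (Dt q p - 2 * h p * Dt h p) - Dt (Dx q) p) p"
    by (rule has_partials_eq_rhs, (rule has_partials_intros q[OF assms(4)] h[OF assms(4)])+)
      (simp_all add: algebra_simps power2_eq_square)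
  then have "has_partials (Dx Q)
     (4 * (q p + \<mu> - (h p)^2)^2
      + 4 * h p * (Dx q p - 2 * h p * (q p + \<mu> - (h p)^2)) - Dx (Dx q) p)
     (4 * Dt h p * (q p + \<mu> - (h p)^2)
      + 4 * h p * (Dt q p - 2 * h p * Dt h p) - Dt (Dx q) p) p"
    by (rule has_partials_transform[OF assms(1,4), rotated]) (rule Q[symmetric])
  then show "Dx (Dx Q) p = 4 * (q p + \<mu> - (h p)^2)^2
      + 4 * h p * (Dx q p - 2 * h p * (q p + \<mu> - (h p)^2)) - Dx (Dx q) p"
    by (rule has_partialsD)
qed

text \<open>
  With \<open>d = h\<^sub>1 - h\<^sub>2\<close> and \<open>c = (\<mu>\<^sub>1 - \<mu>\<^sub>2) / d\<close>, the derivative of the new function \<open>c - h\<^sub>1\<close> is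
  \<open>- h\<^sub>1' - c (h\<^sub>1' - h\<^sub>2') / d\<close>. Eliminating \<open>h\<^sub>2 = h\<^sub>1 - d\<close> and \<open>\<mu>\<^sub>2 = \<mu>\<^sub>1 - c d\<close> turns the two claims,
  multiplied by \<open>d\<close>, into polynomial identities in the independent quantities \<open>c\<close>, \<open>d\<close>, \<open>h\<^sub>1\<close>, \<open>\<mu>\<^sub>1\<close>,
  \<open>q\<close>, \<open>q\<^sub>x\<close>, \<open>q\<^sub>x\<^sub>x\<close>.
\<close>

lemma riccati_pair_permutability:
  assumes "open S" "smooth_on S q"
    and h1: "riccati_pair S q \<mu>1 h1" and h2: "riccati_pair S q \<mu>2 h2"
    and ne: "\<And>p. p \<in> S \<Longrightarrow> h1 p \<noteq> h2 p"
  shows "riccati_pair S (\<lambda>p. 2 * ((h1 p)^2 - \<mu>1) - q p) \<mu>2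
    (\<lambda>p. - h1 p + (\<mu>1 - \<mu>2) / (h1 p - h2 p))"
  unfolding riccati_pair_def
proof
  fix p assume p: "p \<in> S"
  define d where "d = h1 p - h2 p"
  define c where "c = (\<mu>1 - \<mu>2) / d"
  have d: "d \<noteq> 0"
    using ne[OF p] by (simp add: d_def)
  have h2p: "h2 p = h1 p - d"
    by (simp add: d_def)
  have mu2: "\<mu>2 = \<mu>1 - c * d"
    using d by (simp add: c_def)
  let ?X1 = "q p + \<mu>1 - (h1 p)^2" and ?X2 = "q p + \<mu>2 - (h2 p)^2"
  let ?T = "\<lambda>\<mu> h. \<mu>^2 + 1/2 * q p * \<mu> + 1/4 * (Dx (Dx q) p - 2 * (q p)^2)
       - 1/2 * Dx q p * h - (\<mu> - 1/2 * q p) * h^2"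
  have h1': "has_partials h1 ?X1 (?T \<mu>1 (h1 p)) p"
    using h1 p by (simp add: riccati_pair_def)
  have h2': "has_partials h2 ?X2 (?T \<mu>2 (h2 p)) p"
    using h2 p by (simp add: riccati_pair_def)
  define X1 T1 X2 T2 where "X1 = ?X1" and "T1 = ?T \<mu>1 (h1 p)" and "X2 = ?X2" and "T2 = ?T \<mu>2 (h2 p)"
  note XT = X1_def T1_def X2_def T2_def
  have H1: "has_partials (\<lambda>p. h1 p - h2 p) (X1 - X2) (T1 - T2) p"
    by (rule derivative_eq_intros h1'[folded XT] h2'[folded XT])+ (simp add: fun_eq_iff algebra_simps)
  have H2: "has_partials (\<lambda>p. \<mu>1 - \<mu>2) 0 0 p"
    by simp
  have H: "has_partials (\<lambda>p. - h1 p + (\<mu>1 - \<mu>2) / (h1 p - h2 p))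
    (- X1 + (0 - c * (X1 - X2)) / d) (- T1 + (0 - c * (T1 - T2)) / d) p"
    by (rule has_partials_add[OF has_partials_minus[OF h1'[folded XT]]
          has_partials_divide[OF H2 H1 d[unfolded d_def], folded d_def, folded c_def]])
  let ?Q = "\<lambda>p. 2 * ((h1 p)^2 - \<mu>1) - q p" and ?h = "\<lambda>p. - h1 p + (\<mu>1 - \<mu>2) / (h1 p - h2 p)"
  have hp: "?h p = c - h1 p"
    by (simp add: c_def d_def)
  \<comment> \<open>\<open>A\<close> and \<open>B\<close> stand for the derivatives of \<open>h1\<close> and \<open>h2\<close> in one of the two directions.\<close>
  have quotient: "- A + (0 - c * (A - B)) / d = R" if "c * (A - B) = (- A - R) * d" for A B R
    unfolding that using d by simp
  have X: "- X1 + (0 - c * (X1 - X2)) / d = ?Q p + \<mu>2 - (c - h1 p)^2"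
    by (rule quotient) (unfold X1_def X2_def mu2 h2p, algebra)
  have T: "- T1 + (0 - c * (T1 - T2)) / d =
    \<mu>2^2 + 1/2 * ?Q p * \<mu>2 + 1/4 * (Dx (Dx ?Q) p - 2 * (?Q p)^2)
       - 1/2 * Dx ?Q p * (c - h1 p) - (\<mu>2 - 1/2 * ?Q p) * (c - h1 p)^2"
    unfolding darboux_potential_partials[OF assms(1,2) h1 p]
    by (rule quotient) (unfold T1_def T2_def mu2 h2p, algebra)
  show "has_partials ?h (?Q p + \<mu>2 - (?h p)^2)
     (\<mu>2^2 + 1/2 * ?Q p * \<mu>2 + 1/4 * (Dx (Dx ?Q) p - 2 * (?Q p)^2)
       - 1/2 * Dx ?Q p * ?h p - (\<mu>2 - 1/2 * ?Q p) * (?h p)^2) p"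
    unfolding hp using H unfolding X T .
qed

section \<open>Baecklund transformation of the curve flow\<close>

text \<open>
  The additional equation is the \<open>x\<close>-derivative of the flow equation (with \<open>\<gamma>\<^sub>x\<^sub>x = q \<gamma>\<close> inserted), but
  with the mixed derivative taken in the other order, first in \<open>x\<close> and then in \<open>t\<close>. It completes the linear \<open>t\<close>-evolution of the frame
  \<open>(\<gamma>, \<gamma>\<^sub>x)\<close>. Carrying it along, as a property that the Baecklund transformation preserves, replaces an
  appeal to the symmetry of mixed derivatives.
\<close>

definition framed_flow ::
  "(real \<times> real) set \<Rightarrow> (real \<times> real \<Rightarrow> real ^ 2) \<Rightarrow> (real \<times> real \<Rightarrow> real) \<Rightarrow> bool" where
  "framed_flow S \<gamma> q \<longleftrightarrow> central_affine_curve_flow S \<gamma> q \<and>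
     (\<forall>p\<in>S. Dt (Dx \<gamma>) p =
       (1/4 * (Dx (Dx q) p - 2 * (q p)^2)) *\<^sub>R \<gamma> p - (1/4 * Dx q p) *\<^sub>R Dx \<gamma> p)"

lemma det_columns2: "det (columns2 u v) = u $ 1 * v $ 2 - v $ 1 * u $ (2 :: 2)" for u v :: "real ^ 2"
  by (simp add: columns2_def det_2 transpose_def)

text \<open>
  A flow is recognised from a vector field \<open>\<delta>\<close> that is only a candidate for \<open>\<gamma>\<^sub>x\<close>: it suffices that
  \<open>(\<gamma>, \<delta>)\<close> satisfies the Lax pair at parameter \<open>0\<close>.
\<close>

lemma framed_flowI:
  assumes "open S" "smooth_on S \<gamma>" "smooth_on S q"
    and "\<And>p. p \<in> S \<Longrightarrow> has_partials \<gamma> (\<delta> p) ((1/4 * Dx q p) *\<^sub>R \<gamma> p - (1/2 * q p) *\<^sub>R \<delta> p) p"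
    and "\<And>p. p \<in> S \<Longrightarrow> has_partials \<delta> (q p *\<^sub>R \<gamma> p)
      ((1/4 * (Dx (Dx q) p - 2 * (q p)^2)) *\<^sub>R \<gamma> p - (1/4 * Dx q p) *\<^sub>R \<delta> p) p"
    and "\<And>p. p \<in> S \<Longrightarrow> det (columns2 (\<gamma> p) (\<delta> p)) = 1"
  shows "framed_flow S \<gamma> q"
proof -
  have d: "Dx \<gamma> p = \<delta> p" if "p \<in> S" for p
    using assms(4)[OF that] by (rule has_partialsD)
  have dd: "has_partials (Dx \<gamma>) (q p *\<^sub>R \<gamma> p)
      ((1/4 * (Dx (Dx q) p - 2 * (q p)^2)) *\<^sub>R \<gamma> p - (1/4 * Dx q p) *\<^sub>R \<delta> p) p" if "p \<in> S" for p
    using has_partials_transform[OF assms(1) that _ assms(5)[OF that], of "Dx \<gamma>"] d by simp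
  have "\<gamma> p \<noteq> 0" if "p \<in> S" for p
    using assms(6)[OF that] by (auto simp: det_columns2)
  then show ?thesis
    unfolding framed_flow_def central_affine_curve_flow_def central_affine_curvature_def
    using assms(2,3,6) d has_partialsD[OF assms(4)] has_partialsD[OF dd] by simp
qed

lemma framed_flow_partials:
  assumes "open S" "framed_flow S \<gamma> q" "p \<in> S"
  shows "has_partials \<gamma> (Dx \<gamma> p) ((1/4 * Dx q p) *\<^sub>R \<gamma> p - (1/2 * q p) *\<^sub>R Dx \<gamma> p) p"
    and "has_partials (Dx \<gamma>) (q p *\<^sub>R \<gamma> p)
      ((1/4 * (Dx (Dx q) p - 2 * (q p)^2)) *\<^sub>R \<gamma> p - (1/4 * Dx q p) *\<^sub>R Dx \<gamma> p) p"
proof -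
  have s: "smooth_on S \<gamma>" "smooth_on S (Dx \<gamma>)"
    using assms(1,2) smooth_on_Dx unfolding framed_flow_def central_affine_curve_flow_def by blast+
  show "has_partials \<gamma> (Dx \<gamma> p) ((1/4 * Dx q p) *\<^sub>R \<gamma> p - (1/2 * q p) *\<^sub>R Dx \<gamma> p) p"
    using differentiable_imp_has_partials[OF smooth_on_imp_differentiable[OF s(1) assms(3)]] assms(2,3)
    unfolding framed_flow_def central_affine_curve_flow_def by simp
  show "has_partials (Dx \<gamma>) (q p *\<^sub>R \<gamma> p)
      ((1/4 * (Dx (Dx q) p - 2 * (q p)^2)) *\<^sub>R \<gamma> p - (1/4 * Dx q p) *\<^sub>R Dx \<gamma> p) p"
    using differentiable_imp_has_partials[OF smooth_on_imp_differentiable[OF s(2) assms(3)]] assms(2,3)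
    unfolding framed_flow_def central_affine_curve_flow_def central_affine_curvature_def by simp
qed

lemma framed_flow_subset:
  assumes "T \<subseteq> S" "framed_flow S \<gamma> q"
  shows "framed_flow T \<gamma> q"
  using assms(2) smooth_on_subset[OF assms(1), of \<gamma>] smooth_on_subset[OF assms(1), of q] assms(1)
  unfolding framed_flow_def central_affine_curve_flow_def central_affine_curvature_def by blast

lemma framed_flow_smooth:
  assumes "framed_flow S \<gamma> q"
  shows "smooth_on S \<gamma>" "smooth_on S q"
  using assms
  unfolding framed_flow_def central_affine_curve_flow_def central_affine_curvature_def by blast+

lemma framed_flow_transform:
  assumes "open S" "framed_flow S \<gamma> q"
    and "\<And>p. p \<in> S \<Longrightarrow> \<gamma> p = \<gamma>' p" "\<And>p. p \<in> S \<Longrightarrow> q p = q' p"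
  shows "framed_flow S \<gamma>' q'"
proof (rule framed_flowI[where \<delta> = "Dx \<gamma>"])
  note s = framed_flow_smooth[OF assms(2)]
  have q1: "Dx q' p = Dx q p" if "p \<in> S" for p
    using has_partials_transform[OF assms(1) that assms(4)
      differentiable_imp_has_partials[OF smooth_on_imp_differentiable[OF s(2) that]]]
    by (intro has_partialsD)
  have q2: "Dx (Dx q') p = Dx (Dx q) p" if "p \<in> S" for p
    using has_partials_transform[OF assms(1) that _
      differentiable_imp_has_partials[OF smooth_on_imp_differentiable[OF smooth_on_Dx[OF assms(1) s(2)] that]],
      of "Dx q'"] q1
    by (intro has_partialsD) simp
  show "open S" by fact
  show "smooth_on S \<gamma>'" "smooth_on S q'"
    using smooth_on_transform[OF assms(1)] s assms(3,4) by blast+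
  fix p assume p: "p \<in> S"
  show "has_partials \<gamma>' (Dx \<gamma> p) ((1/4 * Dx q' p) *\<^sub>R \<gamma>' p - (1/2 * q' p) *\<^sub>R Dx \<gamma> p) p"
    using has_partials_transform[OF assms(1) p assms(3) framed_flow_partials(1)[OF assms(1,2) p]]
    by (simp add: assms(3,4)[OF p, symmetric] q1 p)
  show "has_partials (Dx \<gamma>) (q' p *\<^sub>R \<gamma>' p)
      ((1/4 * (Dx (Dx q') p - 2 * (q' p)^2)) *\<^sub>R \<gamma>' p - (1/4 * Dx q' p) *\<^sub>R Dx \<gamma> p) p"
    using framed_flow_partials(2)[OF assms(1,2) p]
    by (simp add: assms(3,4)[OF p, symmetric] q1 q2 p)
  show "det (columns2 (\<gamma>' p) (Dx \<gamma> p)) = 1"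
    using assms(2) p unfolding framed_flow_def central_affine_curve_flow_def
    by (simp add: assms(3)[OF p, symmetric])
qed

text \<open>
  By the Riccati equation the \<open>x\<close>-derivative of \<open>(h \<gamma> - \<gamma>\<^sub>x) / k\<close> is \<open>((k\<^sup>2 - h\<^sup>2) \<gamma> + h \<gamma>\<^sub>x) / k\<close>. So the new
  frame is the old one times a matrix of determinant \<open>(h\<^sup>2 + k\<^sup>2 - h\<^sup>2) / k\<^sup>2 = 1\<close>, and both evolution
  equations reduce to comparing the coefficients of \<open>\<gamma>\<close> and \<open>\<gamma>\<^sub>x\<close>.
\<close>

lemma framed_flow_baecklund:
  assumes "open S" "framed_flow S \<gamma> q" "riccati_pair S q (k^2) h" "k \<noteq> 0"
  shows "framed_flow S (baecklund k h \<gamma>) (\<lambda>p. 2 * ((h p)^2 - k^2) - q p)" (is "framed_flow S ?\<gamma> ?q")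
proof (rule framed_flowI)
  let ?\<delta> = "\<lambda>p. (1 / k) *\<^sub>R ((k^2 - (h p)^2) *\<^sub>R \<gamma> p + h p *\<^sub>R Dx \<gamma> p)"
  note s = framed_flow_smooth[OF assms(2)]
  have sh: "smooth_on S h"
    by (rule riccati_pair_smooth[OF assms(1) s(2) assms(3)])
  show "open S" by fact
  show "smooth_on S ?q"
    using sh s unfolding smooth_on_def by (intro allI Cn_on_intros assms(1)) auto
  show "smooth_on S ?\<gamma>"
    using sh s smooth_on_Dx[OF assms(1) s(1)] unfolding smooth_on_def baecklund_def
    by (intro allI Cn_on_intros assms(1)) auto
  fix p assume p: "p \<in> S"
  \<comment> \<open>Both sides are homogeneous in \<open>1 / k\<close>; an opaque name keeps \<open>k\<close> out of the denominators.\<close>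
  obtain c where c: "1 / k = c"
    by simp
  note g = framed_flow_partials[OF assms(1,2) p]
  note h = assms(3)[unfolded riccati_pair_def, rule_format, OF p]
  note Q = darboux_potential_partials[OF assms(1) s(2) assms(3) p]
  show "has_partials ?\<gamma> (?\<delta> p) ((1/4 * Dx ?q p) *\<^sub>R ?\<gamma> p - (1/2 * ?q p) *\<^sub>R ?\<delta> p) p"
    unfolding Q baecklund_def
    by (rule has_partials_eq_rhs, (rule has_partials_intros g h)+)
      (simp_all add: vec_eq_iff c field_simps power2_eq_square)
  show "has_partials ?\<delta> (?q p *\<^sub>R ?\<gamma> p)
      ((1/4 * (Dx (Dx ?q) p - 2 * (?q p)^2)) *\<^sub>R ?\<gamma> p - (1/4 * Dx ?q p) *\<^sub>R ?\<delta> p) p"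
    unfolding Q baecklund_def
    by (rule has_partials_eq_rhs, (rule has_partials_intros g h)+)
      (simp_all add: vec_eq_iff c field_simps power2_eq_square)
  have "det (columns2 (\<gamma> p) (Dx \<gamma> p)) = 1"
    using assms(2) p unfolding framed_flow_def central_affine_curve_flow_def by blast
  then show "det (columns2 (?\<gamma> p) (?\<delta> p)) = 1"
    using assms(4) unfolding det_columns2 baecklund_def
    by (simp add: field_simps power2_eq_square)
qed

text \<open>
  The second column of the frame at \<open>\<mu> = 0\<close> is \<open>\<gamma>\<^sub>x\<close>, so its \<open>t\<close>-derivative can be read off from
  \<open>E\<^sub>t = E B\<close>.
\<close>

lemma framed_flow_of_extended_frame:
  fixes \<gamma> :: "real \<times> real \<Rightarrow> real ^ 2" and E :: "real \<times> real \<Rightarrow> complex \<Rightarrow> complex ^ 2 ^ 2"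
  assumes "central_affine_curve_flow UNIV \<gamma> q" "extended_frame q E"
    and "\<forall>p. E p 0 = map_matrix complex_of_real (columns2 (\<gamma> p) (Dx \<gamma> p))"
  shows "framed_flow UNIV \<gamma> q"
  unfolding framed_flow_def
proof (intro conjI ballI)
  show "central_affine_curve_flow UNIV \<gamma> q" by fact
  fix p :: "real \<times> real"
  have s: "smooth_on UNIV (Dx \<gamma>)"
    using assms(1) smooth_on_Dx[OF open_UNIV] unfolding central_affine_curve_flow_def by blast
  have d: "has_partials (Dx \<gamma>) (Dx (Dx \<gamma>) p) (Dt (Dx \<gamma>) p) p"
    by (rule differentiable_imp_has_partials[OF smooth_on_imp_differentiable[OF s]]) simp
  have E: "has_partials (\<lambda>p. E p 0) (E p 0 ** lax_x q p 0) (E p 0 ** lax_t q p 0) p"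
    using differentiable_imp_has_partials[of "\<lambda>p. E p 0" p] assms(2)
    unfolding extended_frame_def by simp
  show "Dt (Dx \<gamma>) p =
       (1/4 * (Dx (Dx q) p - 2 * (q p)^2)) *\<^sub>R \<gamma> p - (1/4 * Dx q p) *\<^sub>R Dx \<gamma> p"
  proof (rule vec_eq_iff[THEN iffD2], rule allI)
    fix i :: 2
    have "(\<lambda>p. Dx \<gamma> p $ i) = (\<lambda>p. Re (E p 0 $ i $ 2))"
      by (simp add: assms(3) columns2_def transpose_def)
    then have "Dt (\<lambda>p. Dx \<gamma> p $ i) p = Dt (\<lambda>p. Re (E p 0 $ i $ 2)) p"
      by (rule arg_cong)
    also have "\<dots> = Re ((E p 0 ** lax_t q p 0) $ i $ 2)"
      by (rule has_partialsD(2), rule has_partials_bounded_linear[OF bounded_linear_Re],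
          rule has_partials_bounded_linear[OF bounded_linear_vec_nth],
          rule has_partials_bounded_linear[OF bounded_linear_vec_nth], rule E)
    also have "\<dots> =
       ((1/4 * (Dx (Dx q) p - 2 * (q p)^2)) *\<^sub>R \<gamma> p - (1/4 * Dx q p) *\<^sub>R Dx \<gamma> p) $ i"
      by (simp add: assms(3) columns2_def transpose_def
          matrix_matrix_mult_def sum_2 lax_t_def) (simp add: mult.commute)
    finally show "Dt (Dx \<gamma>) p $ i =
       ((1/4 * (Dx (Dx q) p - 2 * (q p)^2)) *\<^sub>R \<gamma> p - (1/4 * Dx q p) *\<^sub>R Dx \<gamma> p) $ i"
      using has_partialsD(2)[OF has_partials_bounded_linear[OF bounded_linear_vec_nth d, of i]]
      by simp
  qed
qed

theorem theorem3p9: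
  fixes \<gamma> \<gamma>1 \<gamma>2 \<gamma>12 :: "real \<times> real \<Rightarrow> real ^ 2"
    and q \<xi>t1 \<xi>t2 \<xi>t12 q12 :: "real \<times> real \<Rightarrow> real"
    and E :: "real \<times> real \<Rightarrow> complex \<Rightarrow> complex ^ 2 ^ 2"
    and \<xi>1 \<xi>2 k1 k2 :: real
    and U :: "(real \<times> real) set"
  assumes flow: "central_affine_curve_flow UNIV \<gamma> q"
    and frame: "extended_frame q E"
    and frame0: "\<forall>p. E p 0 = map_matrix complex_of_real (columns2 (\<gamma> p) (Dx \<gamma> p))"
    and xi: "\<xi>1 \<noteq> \<xi>2"
    and k: "k1 \<noteq> k2" "k1 * k2 \<noteq> 0"
    and U: "open U"
    and nz: "\<forall>p\<in>U. frame_vector E k1 \<xi>1 p $ 2 \<noteq> 0"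
            "\<forall>p\<in>U. frame_vector E k2 \<xi>2 p $ 2 \<noteq> 0"
            "\<forall>p\<in>U. \<xi>t1 p - \<xi>t2 p \<noteq> 0"
    and xi_t1: "\<forall>p\<in>U. \<xi>t1 p = xi_tilde E k1 \<xi>1 p"
    and xi_t2: "\<forall>p\<in>U. \<xi>t2 p = xi_tilde E k2 \<xi>2 p"
    and xi_t12: "\<forall>p\<in>U. \<xi>t12 p = - \<xi>t1 p + (k1^2 - k2^2) / (\<xi>t1 p - \<xi>t2 p)"
    and gamma1: "\<forall>p\<in>U. \<gamma>1 p = baecklund k1 \<xi>t1 \<gamma> p"
    and gamma2: "\<forall>p\<in>U. \<gamma>2 p = baecklund k2 \<xi>t2 \<gamma> p"
    and gamma12: "\<forall>p\<in>U. \<gamma>12 p = baecklund k2 \<xi>t12 \<gamma>1 p"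
    and q12: "\<forall>p\<in>U. q12 p = q p - 2 * ((\<xi>t1 p)^2 - k1^2) + 2 * ((\<xi>t12 p)^2 - k2^2)"
  shows "central_affine_curve_flow U \<gamma>12 q12"
proof -
  define q1 where "q1 = (\<lambda>p. 2 * ((\<xi>t1 p)^2 - k1^2) - q p)"
  have flow0: "framed_flow U \<gamma> q"
    by (rule framed_flow_subset[OF subset_UNIV framed_flow_of_extended_frame[OF flow frame frame0]])
  have h1: "riccati_pair U q (k1^2) \<xi>t1"
    by (rule riccati_pair_transform[OF U _ riccati_pair_xi_tilde[OF frame nz(1)]]) (simp add: xi_t1)
  have h2: "riccati_pair U q (k2^2) \<xi>t2"
    by (rule riccati_pair_transform[OF U _ riccati_pair_xi_tilde[OF frame nz(2)]]) (simp add: xi_t2)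
  have h12: "riccati_pair U q1 (k2^2) \<xi>t12"
    unfolding q1_def
    by (rule riccati_pair_transform[OF U _
          riccati_pair_permutability[OF U framed_flow_smooth(2)[OF flow0] h1 h2]])
      (use nz(3) xi_t12 in auto)
  have "framed_flow U (baecklund k1 \<xi>t1 \<gamma>) q1"
    unfolding q1_def using framed_flow_baecklund[OF U flow0 h1] k(2) by simp
  then have "framed_flow U \<gamma>1 q1"
    by (rule framed_flow_transform[OF U]) (simp_all add: gamma1)
  then have "framed_flow U (baecklund k2 \<xi>t12 \<gamma>1) (\<lambda>p. 2 * ((\<xi>t12 p)^2 - k2^2) - q1 p)"
    using framed_flow_baecklund[OF U _ h12] k(2) by simp
  then have "framed_flow U \<gamma>12 q12"
    by (rule framed_flow_transform[OF U]) (simp_all add: gamma12 q12 q1_def)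
  then show ?thesis
    by (simp add: framed_flow_def)
qed

end
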